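(* Let $S\subset\mathbb H$ be a conjugacy class and let $\boldsymbol\alpha_i=(\alpha_{i,1},\ldots,\alpha_{i,k})$ ($i=1,2,3$) be three spherical chains of the same length $k$, all contained in $S$, with $\alpha_{1,1}\neq\alpha_{2,1}$. Then for every $f\in\mathbb H[z]$ the equality $$\Delta_{\boldsymbol\ell}(\boldsymbol\alpha_3;f)=A\,\Delta_{\boldsymbol\ell}(\boldsymbol\alpha_1;f)+B\,\Delta_{\boldsymbol\ell}(\boldsymbol\alpha_2;f)$$ holds with $$A=V_{\boldsymbol\alpha_3}(T_{\boldsymbol\alpha_3}-T_{\boldsymbol\alpha_2})(T_{\boldsymbol\alpha_1}-T_{\boldsymbol\alpha_2})^{-1}V_{\boldsymbol\alpha_1}^{-1},\qquad B=V_{\boldsymbol\alpha_3}(T_{\boldsymbol\alpha_3}-T_{\boldsymbol\alpha_1})(T_{\boldsymbol\alpha_2}-T_{\boldsymbol\alpha_1})^{-1}V_{\boldsymbol\alpha_2}^{-1}$$ (in particular, the inverses in these formulas exist).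
   Context: $\mathbb H$ is the skew field of (real) quaternions. $\alpha\sim\beta$ means $\alpha=h^{-1}\beta h$ for some nonzero $h\in\mathbb H$; equivalence classes are called conjugacy classes. A spherical chain (of length $k$) is a tuple $\boldsymbol\alpha=(\alpha_1,\ldots,\alpha_k)$ with $\alpha_1\sim\cdots\sim\alpha_k$ and $\alpha_{j+1}\neq\overline{\alpha}_j$ for $j=1,\ldots,k-1$. $\mathbb H[z]$ is the polynomial ring in a variable $z$ commuting with quaternion coefficients. For $f(z)=\sum_{j=0}^m z^jf_j$, the left evaluation is $f^{\boldsymbol{e_\ell}}(\alpha)=\sum\alpha^jf_j$, and $L_\alpha f$ is the unique polynomial with $f=f^{\boldsymbol{e_\ell}}(\alpha)+(z-\alpha)\cdot L_\alpha f$. Left divided differences: $[\alpha_1;f]_{\boldsymbol\ell}=f^{\boldsymbol{e_\ell}}(\alpha_1)$, $[\alpha_1,\ldots,\alpha_j;f]_{\boldsymbol\ell}=(L_{\alpha_{j-1}}\cdots L_{\alpha_1}f)^{\boldsymbol{e_\ell}}(\alpha_j)$ for $j\ge 2$. For $\boldsymbol\alpha=(\alpha_1,\ldots,\alpha_k)$, $\Delta_{\boldsymbol\ell}(\boldsymbol\alpha;f)\in\mathbb H^k$ is the column with entries $[\alpha_1;f]_{\boldsymbol\ell},[\alpha_1,\alpha_2;f]_{\boldsymbol\ell},\ldots,[\alpha_1,\ldots,\alpha_k;f]_{\boldsymbol\ell}$. For a spherical chain $\boldsymbol\alpha=(\alpha_1,\ldots,\alpha_k)$: $V_{\boldsymbol\alpha}$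 is the $k\times k$ matrix with $(i,j)$ entry $[\alpha_1,\ldots,\alpha_i;z^{j-1}]_{\boldsymbol\ell}$ (it is upper triangular with all diagonal entries equal to $1$, hence invertible); $\mathcal J_{\boldsymbol\alpha}$ is the $k\times k$ lower bidiagonal matrix with diagonal entries $\alpha_1,\ldots,\alpha_k$, all entries on the first subdiagonal equal to $1$, and all other entries $0$; and $T_{\boldsymbol\alpha}=V_{\boldsymbol\alpha}^{-1}\mathcal J_{\boldsymbol\alpha}^kV_{\boldsymbol\alpha}$. *)

theory Defs
  imports Complex_Main "HOL-Library.Poly_Mapping" "Jordan_Normal_Form.Matrix"
begin

section \<open>Real quaternions\<close>

datatype quat = Quat (qRe: real) (qI: real) (qJ: real) (qK: real)

instantiation quat :: division_ring
begin

definition zero_quat :: quat where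
  "0 = Quat 0 0 0 0"

definition one_quat :: quat where
  "1 = Quat 1 0 0 0"

definition plus_quat :: "quat \<Rightarrow> quat \<Rightarrow> quat" where
  "x + y = Quat (qRe x + qRe y) (qI x + qI y) (qJ x + qJ y) (qK x + qK y)"

definition minus_quat :: "quat \<Rightarrow> quat \<Rightarrow> quat" where
  "x - y = Quat (qRe x - qRe y) (qI x - qI y) (qJ x - qJ y) (qK x - qK y)"

definition uminus_quat :: "quat \<Rightarrow> quat" where
  "- x = Quat (- qRe x) (- qI x) (- qJ x) (- qK x)"

text \<open>The Hamilton product, i.e. \<open>i\<^sup>2 = j\<^sup>2 = k\<^sup>2 = ijk = -1\<close>.\<close>

definition times_quat :: "quat \<Rightarrow> quat \<Rightarrow> quat" where
  "x * y = Quat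
     (qRe x * qRe y - qI x * qI y - qJ x * qJ y - qK x * qK y)
     (qRe x * qI y + qI x * qRe y + qJ x * qK y - qK x * qJ y)
     (qRe x * qJ y - qI x * qK y + qJ x * qRe y + qK x * qI y)
     (qRe x * qK y + qI x * qJ y - qJ x * qI y + qK x * qRe y)"

definition inverse_quat :: "quat \<Rightarrow> quat" where
  "inverse x = (let n = (qRe x)\<^sup>2 + (qI x)\<^sup>2 + (qJ x)\<^sup>2 + (qK x)\<^sup>2
     in Quat (qRe x / n) (- qI x / n) (- qJ x / n) (- qK x / n))"

definition divide_quat :: "quat \<Rightarrow> quat \<Rightarrow> quat" where
  "x div y = x * inverse (y :: quat)"

instance
proof
  fix a b c :: quat
  show "a + b + c = a + (b + c)" "a + b = b + a" "0 + a = a" "- a + a = 0" "a - b = a + - b"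
    by (simp_all add: zero_quat_def plus_quat_def minus_quat_def uminus_quat_def)
  show "a * b * c = a * (b * c)" "(a + b) * c = a * c + b * c" "a * (b + c) = a * b + a * c"
    by (simp_all add: plus_quat_def times_quat_def algebra_simps)
  show "1 * a = a" "a * 1 = a" "(0 :: quat) \<noteq> 1"
    by (simp_all add: zero_quat_def one_quat_def times_quat_def)
  show "a div b = a * inverse b"
    by (simp add: divide_quat_def)
  show "inverse (0 :: quat) = 0"
    by (simp add: zero_quat_def inverse_quat_def)
  assume "a \<noteq> 0"
  then have "qRe a \<noteq> 0 \<or> qI a \<noteq> 0 \<or> qJ a \<noteq> 0 \<or> qK a \<noteq> 0"
    by (cases a) (simp add: zero_quat_def)
  then have n: "(qRe a)\<^sup>2 + (qI a)\<^sup>2 + (qJ a)\<^sup>2 + (qK a)\<^sup>2 \<noteq> 0"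
    by (smt (verit) zero_le_power2 zero_less_power2)
  then show "inverse a * a = 1" "a * inverse a = 1"
    by (simp_all add: inverse_quat_def Let_def times_quat_def one_quat_def
        add_divide_distrib [symmetric] diff_divide_distrib [symmetric] power2_eq_square
        mult.commute)
qed

end

definition qcnj :: "quat \<Rightarrow> quat" where
  "qcnj x = Quat (qRe x) (- qI x) (- qJ x) (- qK x)"

definition qconj_rel :: "(quat \<times> quat) set" where
  "qconj_rel = {(\<alpha>, \<beta>). \<exists>h. h \<noteq> 0 \<and> \<alpha> = inverse h * \<beta> * h}"

lemma equiv_qconj_rel: "equiv UNIV qconj_rel"
proof (rule equivI)
  show "refl qconj_rel"
  proof (rule refl_onI)
    fix \<alpha> :: quat
    have "(1 :: quat) \<noteq> 0 \<and> \<alpha> = inverse 1 * \<alpha> * 1" by simp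
    then show "(\<alpha>, \<alpha>) \<in> qconj_rel" unfolding qconj_rel_def by blast
  qed
  show "sym qconj_rel"
  proof (rule symI)
    fix \<alpha> \<beta> assume "(\<alpha>, \<beta>) \<in> qconj_rel"
    then obtain h where h: "h \<noteq> 0" "\<alpha> = inverse h * \<beta> * h"
      unfolding qconj_rel_def by blast
    have "inverse (inverse h) * \<alpha> * inverse h = (h * inverse h) * \<beta> * (h * inverse h)"
      unfolding h(2) inverse_inverse_eq by (simp only: mult.assoc)
    also have "\<dots> = \<beta>"
      by (simp only: right_inverse [OF h(1)] mult_1_left mult_1_right)
    finally show "(\<beta>, \<alpha>) \<in> qconj_rel"
      unfolding qconj_rel_def using nonzero_imp_inverse_nonzero [OF h(1)] by blast
  qed
  show "trans qconj_rel"
  proof (rule transI)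
    fix \<alpha> \<beta> \<gamma> assume "(\<alpha>, \<beta>) \<in> qconj_rel" "(\<beta>, \<gamma>) \<in> qconj_rel"
    then obtain h g where h: "h \<noteq> 0" "\<alpha> = inverse h * \<beta> * h"
      and g: "g \<noteq> 0" "\<beta> = inverse g * \<gamma> * g"
      unfolding qconj_rel_def by blast
    have "\<alpha> = inverse (g * h) * \<gamma> * (g * h)"
      unfolding nonzero_inverse_mult_distrib [OF g(1) h(1)] h(2) g(2) by (simp only: mult.assoc)
    moreover have "g * h \<noteq> 0" using g(1) h(1) by simp
    ultimately show "(\<alpha>, \<gamma>) \<in> qconj_rel"
      unfolding qconj_rel_def by blast
  qed
qed simp

text \<open>A tuple \<open>(\<alpha>\<^sub>1, \<dots>, \<alpha>\<^sub>k)\<close> is a list; \<open>\<alpha>\<^sub>j\<close> is the list entry with index \<open>j - 1\<close>.\<close>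

definition spherical_chain :: "quat list \<Rightarrow> bool" where
  "spherical_chain \<alpha> \<longleftrightarrow> \<alpha> \<noteq> [] \<and>
     (\<forall>j. Suc j < length \<alpha> \<longrightarrow>
        (\<alpha> ! j, \<alpha> ! Suc j) \<in> qconj_rel \<and> \<alpha> ! Suc j \<noteq> qcnj (\<alpha> ! j))"

section \<open>Polynomials with a central variable and left divided differences\<close>

text \<open>Multiplication on the type \<open>'a poly\<close> needs commutative coefficients. The convolution
  product on finitely supported functions does not, and it makes the variable commute with the
  coefficients. So \<open>single j c\<close> is the monomial with coefficient \<open>c\<close> at \<open>z ^ j\<close>.\<close>

type_synonym qpoly = "nat \<Rightarrow>\<^sub>0 quat"

abbreviation qconst :: "quat \<Rightarrow> qpoly" where
  "qconst c \<equiv> Poly_Mapping.single 0 c"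

definition qZ :: qpoly where
  "qZ = Poly_Mapping.single 1 1"

definition left_eval :: "qpoly \<Rightarrow> quat \<Rightarrow> quat" where
  "left_eval f \<alpha> = (\<Sum>j\<in>Poly_Mapping.keys f. \<alpha> ^ j * Poly_Mapping.lookup f j)"

definition left_quot :: "quat \<Rightarrow> qpoly \<Rightarrow> qpoly" where
  "left_quot \<alpha> f = (THE g. f = qconst (left_eval f \<alpha>) + (qZ - qconst \<alpha>) * g)"

lemma qZ_diff_neq_0: "qZ - qconst \<alpha> \<noteq> 0"
proof
  assume "qZ - qconst \<alpha> = 0"
  then have "Poly_Mapping.lookup (qZ - qconst \<alpha>) 1 = 0" by simp
  then show False by (simp add: qZ_def lookup_minus lookup_single when_def)
qed

lemma left_eval_superset:
  assumes "finite A" "Poly_Mapping.keys f \<subseteq> A"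
  shows "left_eval f \<alpha> = (\<Sum>j\<in>A. \<alpha> ^ j * Poly_Mapping.lookup f j)"
  unfolding left_eval_def
  by (rule sum.mono_neutral_left) (use assms in \<open>auto simp: in_keys_iff\<close>)

lemma left_eval_add: "left_eval (f + g) \<alpha> = left_eval f \<alpha> + left_eval g \<alpha>"
proof -
  let ?A = "Poly_Mapping.keys f \<union> Poly_Mapping.keys g"
  have "left_eval (f + g) \<alpha> = (\<Sum>j\<in>?A. \<alpha> ^ j * Poly_Mapping.lookup (f + g) j)"
    by (rule left_eval_superset) (simp_all add: Poly_Mapping.keys_add)
  also have "\<dots> = left_eval f \<alpha> + left_eval g \<alpha>"
    by (simp add: left_eval_superset [of ?A f] left_eval_superset [of ?A g] lookup_add
        distrib_left sum.distrib)
  finally show ?thesis .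
qed

lemma left_eval_single: "left_eval (Poly_Mapping.single j c) \<alpha> = \<alpha> ^ j * c"
  by (subst left_eval_superset [of "{j}"]) (auto simp: lookup_single)

lemma left_division_single:
  "\<exists>g. Poly_Mapping.single j c = qconst (\<alpha> ^ j * c) + (qZ - qconst \<alpha>) * g"
proof (induction j)
  case 0
  show ?case by (rule exI [of _ 0]) simp
next
  case (Suc j)
  then obtain g where g:
    "Poly_Mapping.single j c = qconst (\<alpha> ^ j * c) + (qZ - qconst \<alpha>) * g"
    by blast
  have "Poly_Mapping.single (Suc j) c = qZ * Poly_Mapping.single j c"
    by (simp add: qZ_def mult_single)
  also have "\<dots> = qconst \<alpha> * Poly_Mapping.single j c
      + (qZ - qconst \<alpha>) * Poly_Mapping.single j c"
    by (simp add: left_diff_distrib)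
  also have "qconst \<alpha> * Poly_Mapping.single j c
      = qconst \<alpha> * (qconst (\<alpha> ^ j * c) + (qZ - qconst \<alpha>) * g)"
    by (simp only: g)
  also have "\<dots> = qconst (\<alpha> ^ Suc j * c) + qconst \<alpha> * ((qZ - qconst \<alpha>) * g)"
    by (simp add: distrib_left mult_single mult.assoc)
  also have "qconst \<alpha> * ((qZ - qconst \<alpha>) * g) = (qZ - qconst \<alpha>) * (qconst \<alpha> * g)"
    by (simp add: qZ_def mult.assoc [symmetric] left_diff_distrib right_diff_distrib mult_single)
  finally have "Poly_Mapping.single (Suc j) c = qconst (\<alpha> ^ Suc j * c)
      + (qZ - qconst \<alpha>) * (qconst \<alpha> * g + Poly_Mapping.single j c)"
    by (simp only: distrib_left add.assoc)
  then show ?case by blast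
qed

lemma left_division_exists:
  "\<exists>g. f = qconst (left_eval f \<alpha>) + (qZ - qconst \<alpha>) * g"
proof (induction f rule: update_induct)
  case const
  show ?case by (rule exI [of _ 0]) (simp add: left_eval_def)
next
  case (update f j c)
  have upd: "Poly_Mapping.update j c f = Poly_Mapping.single j c + f"
    using update.hyps
    by (intro poly_mapping_eqI) (auto simp: lookup_update lookup_add lookup_single in_keys_iff)
  from update.IH obtain g where g: "f = qconst (left_eval f \<alpha>) + (qZ - qconst \<alpha>) * g" ..
  from left_division_single obtain h where
    h: "Poly_Mapping.single j c = qconst (\<alpha> ^ j * c) + (qZ - qconst \<alpha>) * h" ..
  have "Poly_Mapping.single j c + f = (qconst (\<alpha> ^ j * c) + (qZ - qconst \<alpha>) * h)
      + (qconst (left_eval f \<alpha>) + (qZ - qconst \<alpha>) * g)"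
    using g h by presburger
  also have "\<dots> = qconst (\<alpha> ^ j * c + left_eval f \<alpha>) + (qZ - qconst \<alpha>) * (h + g)"
    by (simp only: single_add distrib_left ac_simps)
  finally show ?case
    unfolding upd left_eval_add left_eval_single by blast
qed

lemma left_division_unique:
  "\<exists>!g. f = qconst (left_eval f \<alpha>) + (qZ - qconst \<alpha>) * g"
proof (rule ex_ex1I [OF left_division_exists])
  fix g h
  assume "f = qconst (left_eval f \<alpha>) + (qZ - qconst \<alpha>) * g"
    and "f = qconst (left_eval f \<alpha>) + (qZ - qconst \<alpha>) * h"
  then have "(qZ - qconst \<alpha>) * g = (qZ - qconst \<alpha>) * h"
    by (metis add_left_cancel)
  with qZ_diff_neq_0 show "g = h" by simp
qed

text \<open>\<open>ldd [\<alpha>\<^sub>1, \<dots>, \<alpha>\<^sub>j] f\<close> is the left divided difference of \<open>f\<close>; the quotient by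
  \<open>z - \<alpha>\<^sub>1\<close> is taken first.\<close>

definition ldd :: "quat list \<Rightarrow> qpoly \<Rightarrow> quat" where
  "ldd \<alpha> f = left_eval (fold left_quot (butlast \<alpha>) f) (last \<alpha>)"

definition Delta_l :: "quat list \<Rightarrow> qpoly \<Rightarrow> quat vec" where
  "Delta_l \<alpha> f = vec (length \<alpha>) (\<lambda>i. ldd (take (Suc i) \<alpha>) f)"

section \<open>The matrices attached to a chain\<close>

text \<open>Two-sided inverse of a square matrix over a possibly noncommutative ring, unspecified for
  matrices that are not invertible.\<close>

definition mat_inv :: "'a :: semiring_1 mat \<Rightarrow> 'a mat" where
  "mat_inv A = (THE B. inverts_mat A B \<and> inverts_mat B A)"

lemma mat_inv_unique:
  fixes A :: "'a :: semiring_1 mat"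
  assumes "inverts_mat A B" "inverts_mat B A"
  shows "mat_inv A = B"
  unfolding mat_inv_def
proof (rule the_equality)
  fix C
  assume C: "inverts_mat A C \<and> inverts_mat C A"
  have dB: "dim_col B = dim_row A" and dA: "dim_col A = dim_row B"
    using arg_cong [OF assms(1) [unfolded inverts_mat_def], of dim_col]
      arg_cong [OF assms(2) [unfolded inverts_mat_def], of dim_col] by simp_all
  have dC: "dim_col C = dim_row A" and dC': "dim_row C = dim_row B"
    using arg_cong [OF conjunct1 [OF C, unfolded inverts_mat_def], of dim_col]
      arg_cong [OF conjunct2 [OF C, unfolded inverts_mat_def], of dim_col] dA by simp_all
  have cA: "A \<in> carrier_mat (dim_row A) (dim_row B)"
    and cB: "B \<in> carrier_mat (dim_row B) (dim_row A)"
    and cC: "C \<in> carrier_mat (dim_row B) (dim_row A)"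
    by (rule carrier_matI; simp add: dA dB dC dC')+
  have AB: "A * B = 1\<^sub>m (dim_row A)" and CA: "C * A = 1\<^sub>m (dim_row B)"
    using assms(1) C dC' by (simp_all add: inverts_mat_def)
  have "C = C * (A * B)"
    unfolding AB by (rule right_mult_one_mat [OF cC, symmetric])
  also have "\<dots> = C * A * B"
    by (rule assoc_mult_mat [OF cC cA cB, symmetric])
  also have "\<dots> = B"
    unfolding CA by (rule left_mult_one_mat [OF cB])
  finally show "C = B" .
qed (use assms in simp)

definition V_mat :: "quat list \<Rightarrow> quat mat" where
  "V_mat \<alpha> = mat (length \<alpha>) (length \<alpha>)
     (\<lambda>(i, j). ldd (take (Suc i) \<alpha>) (qZ ^ j))"

definition J_mat :: "quat list \<Rightarrow> quat mat" where
  "J_mat \<alpha> = mat (length \<alpha>) (length \<alpha>)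
     (\<lambda>(i, j). if i = j then \<alpha> ! i else if i = Suc j then 1 else 0)"

definition T_mat :: "quat list \<Rightarrow> quat mat" where
  "T_mat \<alpha> = mat_inv (V_mat \<alpha>) * (J_mat \<alpha> ^\<^sub>m length \<alpha>) * V_mat \<alpha>"

end

theory Submission
  imports Defs
begin

text \<open>For \<open>\<alpha>\<close> in the class \<open>S\<close> the polynomial \<open>\<chi> = (z - \<alpha>) (z - \<alpha>\<^sup>*)\<close>, with \<open>\<alpha>\<^sup>*\<close> the conjugate of \<open>\<alpha>\<close>,
  has real coefficients that depend only on \<open>S\<close>, so it is central, and \<open>\<Delta>(\<alpha>; \<chi>\<^sup>k g) = 0\<close> for every chain
  of length \<open>k\<close> in \<open>S\<close>. Dividing by \<open>\<chi>\<^sup>k\<close> reduces \<open>f\<close> to \<open>p + z\<^sup>k q\<close> with \<open>p\<close> and \<open>q\<close> of degree below \<open>k\<close>;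
  since multiplication by \<open>z\<close> acts on \<open>\<Delta>\<close> as the matrix \<open>J\<close>, this gives \<open>\<Delta>(\<alpha>; f) = V (p + T q)\<close> with the
  same coefficient vectors \<open>p\<close>, \<open>q\<close> for all chains, and the identity becomes matrix algebra.

  A vector \<open>v\<close> in the kernel of \<open>T\<^sub>1 - T\<^sub>2\<close> yields a polynomial \<open>f = z\<^sup>k v - T\<^sub>1 v\<close> of degree below \<open>2 k\<close> that
  both chains annihilate. If \<open>f = \<chi>\<^sup>m g\<close> with \<open>m < k\<close>, then \<open>g\<close> vanishes at both heads; these are
  distinct points of \<open>S\<close>, so \<open>\<chi>\<close> divides \<open>g\<close>. Hence \<open>\<chi>\<^sup>k\<close> divides \<open>f\<close>, so \<open>f = 0\<close> and \<open>v = 0\<close>.\<close>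

section \<open>Square matrices over division rings\<close>

text \<open>Gaussian elimination, by induction on the number of equations. Unknowns stand to the
  right of the coefficients, so left multiples of the pivot row may be subtracted from the other
  rows and no commutativity enters.\<close>

lemma homogeneous_system:
  fixes a :: "nat \<Rightarrow> 'b \<Rightarrow> 'a :: division_ring"
  assumes "finite J" and "card J > n"
  shows "\<exists>x. (\<exists>j\<in>J. x j \<noteq> 0) \<and> (\<forall>i<n. (\<Sum>j\<in>J. a i j * x j) = 0)"
  using assms
proof (induction n arbitrary: a J)
  case 0
  then have "J \<noteq> {}" by auto
  then show ?case by (intro exI [of _ "\<lambda>_. 1"]) auto
next
  case (Suc n)
  show ?case
  proof (cases "\<forall>j\<in>J. a n j = 0")
    case True
    obtain x where x: "\<exists>j\<in>J. x j \<noteq> 0" "\<forall>i<n. (\<Sum>j\<in>J. a i j * x j) = 0"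
      using Suc.IH [of J a] Suc.prems by auto
    have "(\<Sum>j\<in>J. a n j * x j) = 0" using True by simp
    with x show ?thesis by (intro exI [of _ x]) (auto simp: less_Suc_eq)
  next
    case False
    then obtain p where p: "p \<in> J" "a n p \<noteq> 0" by blast
    define K where "K = J - {p}"
    have K: "finite K" "card K > n"
      using Suc.prems p by (auto simp: K_def)
    obtain y where y: "\<exists>j\<in>K. y j \<noteq> 0"
      and y0: "\<And>i. i < n \<Longrightarrow> (\<Sum>j\<in>K. (a i j - a i p * inverse (a n p) * a n j) * y j) = 0"
      using Suc.IH [OF K, of "\<lambda>i j. a i j - a i p * inverse (a n p) * a n j"] by blast
    define s where "s = (\<Sum>j\<in>K. a n j * y j)"
    \<comment> \<open>This value solves equation \<open>n\<close> for the pivot unknown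
      \<open>x p\<close>.\<close>
    define x where "x = y(p := - (inverse (a n p) * s))"
    have split: "(\<Sum>j\<in>J. a i j * x j) = a i p * x p + (\<Sum>j\<in>K. a i j * y j)" for i
      using Suc.prems(1) p(1) by (simp add: sum.remove [of J p] K_def x_def)
    have "(\<Sum>j\<in>J. a i j * x j) = 0" if "i < n" for i
    proof -
      have "(\<Sum>j\<in>K. a i j * y j) = a i p * inverse (a n p) * s"
        using y0 [OF that]
        by (simp add: s_def left_diff_distrib sum_subtractf sum_distrib_left mult.assoc)
      then show ?thesis unfolding split by (simp add: x_def mult.assoc)
    qed
    moreover have "(\<Sum>j\<in>J. a n j * x j) = 0"
      unfolding split using p(2) by (simp add: x_def s_def [symmetric] mult.assoc [symmetric])
    moreover have "\<exists>j\<in>J. x j \<noteq> 0"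
      using y by (auto simp: x_def K_def)
    ultimately show ?thesis
      by (intro exI [of _ x]) (auto simp: less_Suc_eq)
  qed
qed

text \<open>The \<open>n + 1\<close> columns of \<open>A\<close> augmented by \<open>b\<close>
  satisfy a nontrivial relation with coefficients on the right. Injectivity forbids a zero
  coefficient at \<open>b\<close>, and right scaling turns that coefficient into -1.\<close>

lemma inj_mat_solvable:
  fixes A :: "'a :: division_ring mat"
  assumes A: "A \<in> carrier_mat n n"
    and inj: "\<And>v. v \<in> carrier_vec n \<Longrightarrow> A *\<^sub>v v = 0\<^sub>v n \<Longrightarrow> v = 0\<^sub>v n"
    and b: "b \<in> carrier_vec n"
  shows "\<exists>v \<in> carrier_vec n. A *\<^sub>v v = b"
proof -
  obtain x where x: "\<exists>j\<in>{..<Suc n}. x j \<noteq> 0"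
    and x0: "\<And>i. i < n \<Longrightarrow> (\<Sum>j\<in>{..<Suc n}. (if j < n then A $$ (i, j) else b $ i) * x j) = 0"
    using homogeneous_system [of "{..<Suc n}" n "\<lambda>i j. if j < n then A $$ (i, j) else b $ i"]
    by auto
  have eq: "(\<Sum>j<n. A $$ (i, j) * x j) + b $ i * x n = 0" if "i < n" for i
    using x0 [OF that] by simp
  have "x n \<noteq> 0"
  proof
    assume xn: "x n = 0"
    have "A *\<^sub>v vec n x = 0\<^sub>v n"
      using A eq xn by (intro eq_vecI) (auto simp: scalar_prod_def lessThan_atLeast0)
    then have z: "vec n x = 0\<^sub>v n" by (rule inj [rotated]) auto
    have "x j = 0" if "j < n" for j
      using arg_cong [OF z, of "\<lambda>v. v $ j"] that by simp
    with x xn show False by (auto simp: less_Suc_eq)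
  qed
  define c where "c = - inverse (x n)"
  have c: "x n * c = - 1" using \<open>x n \<noteq> 0\<close> by (simp add: c_def)
  have "A *\<^sub>v vec n (\<lambda>j. x j * c) = b"
  proof (intro eq_vecI)
    fix i assume "i < dim_vec b"
    then have i: "i < n" using b by simp
    have "(A *\<^sub>v vec n (\<lambda>j. x j * c)) $ i = (\<Sum>j<n. A $$ (i, j) * (x j * c))"
      using A i by (simp add: scalar_prod_def lessThan_atLeast0)
    also have "\<dots> = (\<Sum>j<n. A $$ (i, j) * x j) * c"
      by (simp only: sum_distrib_right mult.assoc)
    also have "(\<Sum>j<n. A $$ (i, j) * x j) = - (b $ i * x n)"
      using eq [OF i] by (simp only: eq_neg_iff_add_eq_0)
    also have "- (b $ i * x n) * c = b $ i"
      by (simp add: mult.assoc c)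
    finally show "(A *\<^sub>v vec n (\<lambda>j. x j * c)) $ i = b $ i" .
  qed (use A b in auto)
  then show ?thesis by (intro bexI [of _ "vec n (\<lambda>j. x j * c)"]) auto
qed

text \<open>Solutions of \<open>A v = e_j\<close> are the columns of a right inverse
  \<open>B\<close>. Then \<open>A (B A - 1) = 0\<close>, and injectivity applied to each column
  gives \<open>B A = 1\<close>.\<close>

lemma inj_mat_inverse:
  fixes A :: "'a :: division_ring mat"
  assumes A: "A \<in> carrier_mat n n"
    and inj: "\<And>v. v \<in> carrier_vec n \<Longrightarrow> A *\<^sub>v v = 0\<^sub>v n \<Longrightarrow> v = 0\<^sub>v n"
  shows "\<exists>B \<in> carrier_mat n n. A * B = 1\<^sub>m n \<and> B * A = 1\<^sub>m n"
proof -
  have "\<exists>v. v \<in> carrier_vec n \<and> A *\<^sub>v v = unit_vec n j" for j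
    using inj_mat_solvable [OF A inj, of "unit_vec n j"] by auto
  then obtain w where w: "\<And>j. w j \<in> carrier_vec n" "\<And>j. A *\<^sub>v w j = unit_vec n j"
    by metis
  define B where "B = mat n n (\<lambda>(i, j). w j $ i)"
  have B: "B \<in> carrier_mat n n" by (simp add: B_def)
  have colB: "col B j = w j" if "j < n" for j
    using w(1) [of j] that by (intro eq_vecI) (auto simp: B_def)
  have AB: "A * B = 1\<^sub>m n"
  proof (rule mat_col_eqI)
    fix j assume "j < dim_col (1\<^sub>m n :: 'a mat)"
    then have j: "j < n" by simp
    then show "col (A * B) j = col (1\<^sub>m n) j"
      using col_mult2 [OF A B j] by (simp add: colB w)
  qed (use A B in auto)
  have BA: "B * A \<in> carrier_mat n n" using A B by simp
  have "A * (B * A) = A"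
    using assoc_mult_mat [OF A B A, symmetric] AB A by simp
  then have zero: "A * (B * A - 1\<^sub>m n) = 0\<^sub>m n n"
    using mult_minus_distrib_mat [OF A BA one_carrier_mat] A by simp
  have C: "B * A - 1\<^sub>m n \<in> carrier_mat n n" by (simp add: minus_carrier_mat)
  have col0: "col (B * A - 1\<^sub>m n) j = 0\<^sub>v n" if j: "j < n" for j
  proof (rule inj)
    show "col (B * A - 1\<^sub>m n) j \<in> carrier_vec n" by (rule carrier_vecI) simp
    show "A *\<^sub>v col (B * A - 1\<^sub>m n) j = 0\<^sub>v n"
      using col_mult2 [OF A C j] zero j by simp
  qed
  have "B * A = 1\<^sub>m n"
  proof (rule eq_matI)
    fix i j assume "i < dim_row (1\<^sub>m n :: 'a mat)" "j < dim_col (1\<^sub>m n :: 'a mat)"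
    then have ij: "i < n" "j < n" by auto
    have "col (B * A - 1\<^sub>m n) j $ i = 0" using col0 [OF ij(2)] ij by simp
    then show "(B * A) $$ (i, j) = 1\<^sub>m n $$ (i, j)"
      using ij A B by simp
  qed (use A B in auto)
  with AB B show ?thesis by blast
qed

section \<open>Quaternion conjugacy classes\<close>

abbreviation qreal :: "real \<Rightarrow> quat" where
  "qreal r \<equiv> Quat r 0 0 0"

lemma qreal_commute: "qreal r * x = x * qreal r"
  by (simp add: times_quat_def)

text \<open>The numbers \<open>t\<close> and \<open>n\<close> are the trace and the norm of
  \<open>x\<close>. Membership in the conjugacy class enters the later arguments only through
  them.\<close>

definition in_class :: "real \<Rightarrow> real \<Rightarrow> quat \<Rightarrow> bool" where
  "in_class t n x \<longleftrightarrow> x + qcnj x = qreal t \<and> x * qcnj x = qreal n"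

lemma in_class_qcnj: "in_class t n x \<Longrightarrow> in_class t n (qcnj x)"
  by (cases x) (auto simp: in_class_def qcnj_def plus_quat_def times_quat_def)

lemma qcnj_qcnj [simp]: "qcnj (qcnj x) = x"
  by (cases x) (simp add: qcnj_def)

lemma qcnj_mult: "qcnj (x * y) = qcnj y * qcnj x"
  by (simp add: qcnj_def times_quat_def)

lemma qcnj_one: "qcnj 1 = 1"
  by (simp add: qcnj_def one_quat_def)

lemma self_mult_qcnj:
  "x * qcnj x = qreal ((qRe x)\<^sup>2 + (qI x)\<^sup>2 + (qJ x)\<^sup>2 + (qK x)\<^sup>2)"
  by (simp add: qcnj_def times_quat_def power2_eq_square)

text \<open>The real part of a product is invariant under cyclic shifts, which settles the trace.
  The norm is preserved because norms are real, hence central.\<close>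

lemma in_class_conjugate:
  assumes h: "h \<noteq> 0" and s: "s = inverse h * x * h" and c: "in_class t n s"
  shows "in_class t n x"
proof -
  have x: "x = h * s * inverse h"
    using h by (simp add: s mult.assoc [symmetric]) (simp add: mult.assoc)
  have "qRe x = qRe (inverse h * h * s)"
    by (simp add: x times_quat_def algebra_simps)
  then have re: "qRe x = qRe s" using h by simp
  obtain r where r: "inverse h * qcnj (inverse h) = qreal r" using self_mult_qcnj by blast
  have "x * qcnj x = h * s * (inverse h * qcnj (inverse h)) * qcnj s * qcnj h"
    by (simp only: x qcnj_mult mult.assoc)
  \<comment> \<open>The real norm of \<open>inverse h\<close> moves past \<open>qcnj s\<close>, so
    that \<open>s * qcnj s\<close> can be evaluated; afterwards it returns to cancel
    \<open>h\<close> and \<open>qcnj h\<close>.\<close>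
  also have "\<dots> = h * (s * qcnj s) * qreal r * qcnj h"
    unfolding r by (simp only: qreal_commute [of r "qcnj s * qcnj h"] mult.assoc qreal_commute [of r "qcnj s"] qreal_commute [of r "qcnj h"])
  also have "\<dots> = qreal n * (h * (inverse h * qcnj (inverse h)) * qcnj h)"
    using c by (simp only: in_class_def r qreal_commute [of n] mult.assoc)
  also have "\<dots> = qreal n * ((h * inverse h) * qcnj (h * inverse h))"
    by (simp only: mult.assoc qcnj_mult)
  also have "\<dots> = qreal n"
    using right_inverse [OF h] by (simp add: qcnj_one)
  finally show ?thesis
    using c re by (simp add: in_class_def qcnj_def plus_quat_def)
qed

lemma conjugacy_class_in_class:
  assumes "S \<in> UNIV // qconj_rel"
  shows "\<exists>t n. \<forall>x\<in>S. in_class t n x"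
proof -
  obtain s where S: "S = qconj_rel `` {s}" using assms by (auto elim: quotientE)
  have "in_class (2 * qRe s) ((qRe s)\<^sup>2 + (qI s)\<^sup>2 + (qJ s)\<^sup>2 + (qK s)\<^sup>2) s"
    unfolding in_class_def self_mult_qcnj by (simp add: qcnj_def plus_quat_def)
  then have "\<forall>x\<in>S. in_class (2 * qRe s) ((qRe s)\<^sup>2 + (qI s)\<^sup>2 + (qJ s)\<^sup>2 + (qK s)\<^sup>2) x"
    using in_class_conjugate by (auto simp: S qconj_rel_def)
  then show ?thesis by blast
qed

section \<open>Left division by linear factors\<close>

lemma qpoly_induct [case_names zero single add]:
  fixes f :: qpoly
  assumes "P 0" and "\<And>j c. P (Poly_Mapping.single j c)"
    and "\<And>f g. P f \<Longrightarrow> P g \<Longrightarrow> P (f + g)"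
  shows "P f"
proof (induction f rule: update_induct)
  case const
  show ?case by (rule assms(1))
next
  case (update f j c)
  have "Poly_Mapping.update j c f = Poly_Mapping.single j c + f"
    using update.hyps
    by (intro poly_mapping_eqI) (auto simp: lookup_update lookup_add lookup_single in_keys_iff)
  then show ?case using assms(2,3) update.IH by metis
qed

text \<open>For a monomial \<open>g\<close> with exponent j and coefficient c, the product evaluates
  to \<open>a^(j+1) c - a^j (a c) = 0\<close>; additivity does the rest.\<close>

lemma left_eval_factor: "left_eval ((qZ - qconst a) * g) a = 0"
proof (induction g rule: qpoly_induct)
  case zero
  show ?case by (simp add: left_eval_def)
next
  case (single j c)
  have "(qZ - qconst a) * Poly_Mapping.single j c
      = Poly_Mapping.single (Suc j) c + Poly_Mapping.single j (- (a * c))"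
    by (simp add: qZ_def left_diff_distrib mult_single single_uminus)
  then show ?case
    by (simp add: left_eval_add left_eval_single power_Suc2 mult.assoc del: power_Suc)
next
  case (add f g)
  then show ?case by (simp add: distrib_left left_eval_add)
qed

text \<open>By uniqueness of the division, a single decomposition identifies the value and the
  quotient at once. The computation rules below come from this.\<close>

lemma left_division_eqI:
  assumes "f = qconst c + (qZ - qconst a) * g"
  shows "left_eval f a = c" and "left_quot a f = g"
proof -
  show c: "left_eval f a = c"
    by (simp add: assms left_eval_add left_eval_factor left_eval_single)
  show "left_quot a f = g"
    unfolding left_quot_def
    by (rule the1_equality [OF left_division_unique]) (use assms c in simp)
qed

lemma left_division: "f = qconst (left_eval f a) + (qZ - qconst a) * left_quot a f"
  unfolding left_quot_def by (rule theI' [OF left_division_unique])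

lemma left_quot_factor [simp]: "left_quot a ((qZ - qconst a) * g) = g"
  by (rule left_division_eqI(2) [of _ 0]) simp

lemma left_quot_const [simp]: "left_quot a (qconst c) = 0"
  by (rule left_division_eqI(2) [of _ c]) simp

lemma left_quot_add: "left_quot a (f + g) = left_quot a f + left_quot a g"
proof (rule left_division_eqI(2) [of _ "left_eval f a + left_eval g a"])
  have "f + g = (qconst (left_eval f a) + (qZ - qconst a) * left_quot a f)
      + (qconst (left_eval g a) + (qZ - qconst a) * left_quot a g)"
    using left_division [of f a] left_division [of g a] by presburger
  then show "f + g = qconst (left_eval f a + left_eval g a)
      + (qZ - qconst a) * (left_quot a f + left_quot a g)"
    by (simp only: single_add distrib_left ac_simps)
qed

lemma
  shows left_eval_mult_const: "left_eval (f * qconst c) a = left_eval f a * c"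
    and left_quot_mult_const: "left_quot a (f * qconst c) = left_quot a f * qconst c"
proof -
  have "f * qconst c = (qconst (left_eval f a) + (qZ - qconst a) * left_quot a f) * qconst c"
    using left_division [of f a] by simp
  also have "\<dots> = qconst (left_eval f a * c) + (qZ - qconst a) * (left_quot a f * qconst c)"
    by (simp only: distrib_right mult_single mult.assoc add_0)
  finally have *: "f * qconst c = qconst (left_eval f a * c) + (qZ - qconst a) * (left_quot a f * qconst c)" .
  show "left_eval (f * qconst c) a = left_eval f a * c"
    and "left_quot a (f * qconst c) = left_quot a f * qconst c"
    using left_division_eqI [OF *] by auto
qed

lemma qZ_commute_const: "qZ * qconst c = qconst c * qZ"
  by (simp add: qZ_def mult_single)

text \<open>The variable commutes with \<open>z - a\<close>, so the decomposition of
  \<open>f\<close> can be multiplied by z. The constant left behind in the quotient is the source of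
  the subdiagonal ones in \<open>J_mat\<close>.\<close>

lemma
  shows left_eval_qZ_mult: "left_eval (qZ * f) a = a * left_eval f a"
    and left_quot_qZ_mult: "left_quot a (qZ * f) = qconst (left_eval f a) + qZ * left_quot a f"
proof -
  have "qZ * f = qZ * (qconst (left_eval f a) + (qZ - qconst a) * left_quot a f)"
    using left_division [of f a] by simp
  also have "\<dots> = qconst a * qconst (left_eval f a)
      + (qZ - qconst a) * qconst (left_eval f a) + (qZ * (qZ - qconst a)) * left_quot a f"
    by (simp add: left_diff_distrib distrib_left mult.assoc)
  also have "qZ * (qZ - qconst a) = (qZ - qconst a) * qZ"
    by (simp add: left_diff_distrib right_diff_distrib qZ_commute_const)
  also have "qconst a * qconst (left_eval f a) = qconst (a * left_eval f a)"
    by (simp add: mult_single)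
  finally have *: "qZ * f = qconst (a * left_eval f a)
      + (qZ - qconst a) * (qconst (left_eval f a) + qZ * left_quot a f)"
    by (simp only: distrib_left mult.assoc add.assoc)
  show "left_eval (qZ * f) a = a * left_eval f a"
    and "left_quot a (qZ * f) = qconst (left_eval f a) + qZ * left_quot a f"
    using left_division_eqI [OF *] by auto
qed

section \<open>The characteristic polynomial of a conjugacy class\<close>

text \<open>Given by its real coefficients and not as a product, so that no representative of the
  class is singled out.\<close>

definition chi :: "real \<Rightarrow> real \<Rightarrow> qpoly" where
  "chi t n = qZ * qZ - qconst (qreal t) * qZ + qconst (qreal n)"

lemma chi_factor:
  assumes "in_class t n a"
  shows "chi t n = (qZ - qconst a) * (qZ - qconst (qcnj a))"
proof -
  have "(qZ - qconst a) * (qZ - qconst (qcnj a))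
      = qZ * qZ - (qconst a + qconst (qcnj a)) * qZ + qconst a * qconst (qcnj a)"
    by (simp add: left_diff_distrib right_diff_distrib distrib_right qZ_commute_const)
  also have "\<dots> = chi t n"
    using assms by (simp add: chi_def in_class_def single_add [symmetric] mult_single)
  finally show ?thesis by simp
qed

text \<open>Both z and the real coefficients are central. Commuting with linear factors is enough
  for moving \<open>chi\<close> through successive divisions.\<close>

lemma chi_commute: "chi t n * (qZ - qconst c) = (qZ - qconst c) * chi t n"
proof -
  have real: "qconst (qreal r) * qconst d = qconst d * qconst (qreal r)" for r d
    by (simp add: mult_single qreal_commute [of r d])
  have "qZ * (qconst (qreal t) * qZ) = qconst (qreal t) * qZ * qZ"
    by (simp add: qZ_commute_const mult.assoc [symmetric])
  moreover have "qconst c * (qconst (qreal t) * qZ) = qconst (qreal t) * qZ * qconst c"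
    by (simp add: mult.assoc qZ_commute_const) (simp add: mult.assoc [symmetric] real)
  moreover have "qconst c * (qZ * qZ) = qZ * qZ * qconst c"
    by (simp add: mult.assoc qZ_commute_const) (simp add: mult.assoc [symmetric] qZ_commute_const)
  ultimately show ?thesis
    unfolding chi_def left_diff_distrib right_diff_distrib distrib_left distrib_right
    by (simp add: mult.assoc real qZ_commute_const)
qed

lemma chi_power_commute: "chi t n ^ m * (qZ - qconst c) = (qZ - qconst c) * chi t n ^ m"
  by (induction m) (simp_all add: mult.assoc chi_commute, simp add: mult.assoc [symmetric] chi_commute)

lemma chi_mult:
  "in_class t n a \<Longrightarrow> chi t n * g = (qZ - qconst a) * ((qZ - qconst (qcnj a)) * g)"
  by (simp add: chi_factor mult.assoc)

section \<open>Zeros within one conjugacy class\<close>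

text \<open>With \<open>d\<close> the value of \<open>h\<close> at \<open>qcnj c\<close>, the
  product is \<open>(z - c) d\<close> plus a multiple of \<open>chi\<close>. The latter vanishes at
  \<open>a\<close> and the former has value \<open>(a - c) d\<close> there, so
  \<open>d = 0\<close>.\<close>

lemma left_eval_factor_eq_0:
  assumes "in_class t n a" and "in_class t n c" and "a \<noteq> c"
    and "left_eval ((qZ - qconst c) * h) a = 0"
  shows "left_eval h (qcnj c) = 0"
proof -
  define d where "d = left_eval h (qcnj c)"
  define h' where "h' = left_quot (qcnj c) h"
  have "h = qconst d + (qZ - qconst (qcnj c)) * h'"
    unfolding d_def h'_def by (rule left_division)
  then have "(qZ - qconst c) * h = (qZ - qconst c) * qconst d + chi t n * h'"
    by (simp add: chi_mult [OF assms(2)] distrib_left)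
  also have "(qZ - qconst c) * qconst d = qconst ((a - c) * d) + (qZ - qconst a) * qconst d"
    by (simp add: left_diff_distrib mult_single single_diff)
  also have "\<dots> + chi t n * h' = qconst ((a - c) * d)
      + (qZ - qconst a) * (qconst d + (qZ - qconst (qcnj a)) * h')"
    by (simp only: chi_mult [OF assms(1)] distrib_left add.assoc)
  finally have "left_eval ((qZ - qconst c) * h) a = (a - c) * d"
    by (rule left_division_eqI)
  with assms(3,4) show ?thesis by (simp add: d_def)
qed

lemma left_eval_0_factor: "left_eval f a = 0 \<Longrightarrow> f = (qZ - qconst a) * left_quot a f"
  using left_division [of f a] by simp

text \<open>The zero at \<open>a\<close> splits off \<open>z - a\<close>; the zero at
  \<open>b\<close> then forces the quotient to vanish at \<open>qcnj a\<close>, and the two linear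
  factors multiply to \<open>chi\<close>.\<close>

lemma chi_dvd_of_two_zeros:
  assumes "in_class t n a" and "in_class t n b" and "a \<noteq> b"
    and "left_eval f a = 0" and "left_eval f b = 0"
  shows "\<exists>g. f = chi t n * g"
proof -
  define g where "g = left_quot a f"
  have f: "f = (qZ - qconst a) * g"
    unfolding g_def using assms(4) by (rule left_eval_0_factor)
  then have "left_eval g (qcnj a) = 0"
    using left_eval_factor_eq_0 [OF assms(2,1)] assms(3,5) by auto
  then have "g = (qZ - qconst (qcnj a)) * left_quot (qcnj a) g"
    by (rule left_eval_0_factor)
  then have "f = chi t n * left_quot (qcnj a) g"
    unfolding f chi_mult [OF assms(1)] by simp
  then show ?thesis ..
qed

section \<open>Degree bounds and division by powers of chi\<close>

text \<open>The bound is strict, so it matches coefficient vectors of length \<open>n\<close>, and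
  \<open>deg_below 0\<close> singles out the zero polynomial.\<close>

definition deg_below :: "nat \<Rightarrow> qpoly \<Rightarrow> bool" where
  "deg_below n f \<longleftrightarrow> (\<forall>i\<ge>n. Poly_Mapping.lookup f i = 0)"

lemma lookup_qZ_mult:
  "Poly_Mapping.lookup (qZ * f) i = (case i of 0 \<Rightarrow> 0 | Suc j \<Rightarrow> Poly_Mapping.lookup f j)"
  by (induction f rule: qpoly_induct)
    (auto simp: qZ_def mult_single lookup_single when_def distrib_left lookup_add split: nat.split)

lemma lookup_const_mult:
  "Poly_Mapping.lookup (qconst c * f) i = c * Poly_Mapping.lookup f i"
  by (induction f rule: qpoly_induct)
    (auto simp: mult_single lookup_single when_def distrib_left lookup_add)

lemma lookup_factor_mult:
  "Poly_Mapping.lookup ((qZ - qconst a) * f) (Suc i)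
    = Poly_Mapping.lookup f i - a * Poly_Mapping.lookup f (Suc i)"
  by (simp add: left_diff_distrib lookup_minus lookup_qZ_mult lookup_const_mult)

text \<open>As \<open>z - a\<close> is monic, the leading coefficient of \<open>g\<close> reappears
  one degree higher in the product.\<close>

lemma deg_below_factor:
  assumes "deg_below n ((qZ - qconst a) * g)"
  shows "deg_below (n - 1) g"
  unfolding deg_below_def
proof (intro allI impI, rule ccontr)
  fix i assume i: "n - 1 \<le> i" "Poly_Mapping.lookup g i \<noteq> 0"
  define M where "M = Max (Poly_Mapping.keys g)"
  have ne: "Poly_Mapping.keys g \<noteq> {}" and iM: "i \<le> M"
    using i by (auto simp: M_def in_keys_iff)
  have M: "Poly_Mapping.lookup g M \<noteq> 0"
    using Max_in [OF finite_keys ne] by (simp add: M_def in_keys_iff)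
  have "Poly_Mapping.lookup g (Suc M) = 0"
    using Max_ge [OF finite_keys, of "Suc M" g] by (metis M_def Suc_n_not_le_n in_keys_iff)
  then have "Poly_Mapping.lookup ((qZ - qconst a) * g) (Suc M) \<noteq> 0"
    using M by (simp add: lookup_factor_mult)
  then show False using assms i(1) iM by (auto simp: deg_below_def)
qed

lemma deg_below_factor_mult:
  "deg_below n g \<Longrightarrow> deg_below (Suc n) ((qZ - qconst a) * g)"
  unfolding deg_below_def
proof (intro allI impI)
  fix i assume g: "\<forall>i\<ge>n. Poly_Mapping.lookup g i = 0" and "Suc n \<le> i"
  then obtain j where "i = Suc j" "n \<le> j" by (metis Suc_le_D Suc_le_mono)
  with g show "Poly_Mapping.lookup ((qZ - qconst a) * g) i = 0"
    by (simp add: lookup_factor_mult)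
qed

lemma deg_below_0: "deg_below 0 f \<Longrightarrow> f = 0"
  by (intro poly_mapping_eqI) (simp add: deg_below_def)

lemma deg_below_add: "deg_below n f \<Longrightarrow> deg_below n g \<Longrightarrow> deg_below n (f + g)"
  by (simp add: deg_below_def lookup_add)

lemma deg_below_mono: "deg_below m f \<Longrightarrow> m \<le> n \<Longrightarrow> deg_below n f"
  by (auto simp: deg_below_def)

lemma deg_below_const: "deg_below 1 (qconst c)"
  by (auto simp: deg_below_def lookup_single when_def)

text \<open>The power of \<open>chi\<close> is monic of degree \<open>2 * m\<close>, which leaves no
  room for a nonzero cofactor. Each induction step strips the two linear factors of one
  \<open>chi\<close>.\<close>

lemma chi_power_mult_eq_0:
  assumes "in_class t n a" and "deg_below (2 * m) (chi t n ^ m * g)"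
  shows "g = 0"
  using assms(2)
proof (induction m)
  case 0
  then show ?case by (simp add: deg_below_0)
next
  case (Suc m)
  have "deg_below (2 * Suc m - 1 - 1) (chi t n ^ m * g)"
    using Suc.prems chi_mult [OF assms(1), of "chi t n ^ m * g"]
    by (intro deg_below_factor) (simp add: mult.assoc)
  then show ?case using Suc.IH by simp
qed

text \<open>Dividing by \<open>z - a\<close> and then by \<open>z - qcnj a\<close> is division by
  \<open>chi\<close> with a remainder of degree below 2; the quotient is divided further by
  induction.\<close>

lemma chi_power_division:
  assumes "in_class t n a"
  shows "\<exists>g r. f = chi t n ^ m * g + r \<and> deg_below (2 * m) r"
proof (induction m arbitrary: f)
  case 0
  show ?case by (intro exI [of _ f] exI [of _ 0]) (simp add: deg_below_def)
next
  case (Suc m)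
  define c g0 where "c = left_eval f a" and "g0 = left_quot a f"
  define d g1 where "d = left_eval g0 (qcnj a)" and "g1 = left_quot (qcnj a) g0"
  obtain g r where g: "g1 = chi t n ^ m * g + r" and r: "deg_below (2 * m) r"
    using Suc.IH by blast
  have f0: "f = qconst c + (qZ - qconst a) * g0"
    unfolding c_def g0_def by (rule left_division)
  have g0: "g0 = qconst d + (qZ - qconst (qcnj a)) * g1"
    unfolding d_def g1_def by (rule left_division)
  \<comment> \<open>The remainder of the quotient \<open>g1\<close> is raised by two degrees, and
    the linear remainder of the first division fills the gap.\<close>
  define r' where "r' = chi t n * r + ((qZ - qconst a) * qconst d + qconst c)"
  have "f = qconst c + (qZ - qconst a) * qconst d + chi t n * g1"
    by (subst f0, subst g0) (simp add: chi_mult [OF assms] distrib_left add.assoc)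
  also have "\<dots> = chi t n ^ Suc m * g + r'"
    by (simp add: g r'_def distrib_left mult.assoc ac_simps)
  finally have "f = chi t n ^ Suc m * g + r'" .
  moreover have "deg_below (2 * Suc m) (chi t n * r)"
    using deg_below_factor_mult [OF deg_below_factor_mult [OF r]]
    by (simp add: chi_mult [OF assms])
  then have "deg_below (2 * Suc m) r'"
    unfolding r'_def
    by (intro deg_below_add)
      (auto intro: deg_below_mono [OF deg_below_const] deg_below_mono [OF deg_below_factor_mult [OF deg_below_const]])
  ultimately show ?case by blast
qed

section \<open>Divided differences along a chain\<close>

lemma fold_left_quot_add:
  "fold left_quot xs (f + g) = fold left_quot xs f + fold left_quot xs g"
  by (induction xs arbitrary: f g) (simp_all add: left_quot_add)

lemma fold_left_quot_mult_const:
  "fold left_quot xs (f * qconst c) = fold left_quot xs f * qconst c"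
  by (induction xs arbitrary: f) (simp_all add: left_quot_mult_const)

lemma ldd_take:
  "i < length \<alpha> \<Longrightarrow> ldd (take (Suc i) \<alpha>) f = left_eval (fold left_quot (take i \<alpha>) f) (\<alpha> ! i)"
  by (simp add: ldd_def take_Suc_conv_app_nth)

lemma ldd_add: "ldd xs (f + g) = ldd xs f + ldd xs g"
  by (simp add: ldd_def fold_left_quot_add left_eval_add)

lemma ldd_mult_const: "ldd xs (f * qconst c) = ldd xs f * c"
  by (simp add: ldd_def fold_left_quot_mult_const left_eval_mult_const)

lemma Delta_l_carrier [simp]: "Delta_l \<alpha> f \<in> carrier_vec (length \<alpha>)"
  by (simp add: Delta_l_def)

lemma Delta_l_index:
  "i < length \<alpha> \<Longrightarrow> Delta_l \<alpha> f $ i = left_eval (fold left_quot (take i \<alpha>) f) (\<alpha> ! i)"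
  by (simp add: Delta_l_def ldd_take)

lemma Delta_l_add: "Delta_l \<alpha> (f + g) = Delta_l \<alpha> f + Delta_l \<alpha> g"
  by (intro eq_vecI) (auto simp: Delta_l_def ldd_add)

lemma V_mat_carrier [simp]: "V_mat \<alpha> \<in> carrier_mat (length \<alpha>) (length \<alpha>)"
  by (simp add: V_mat_def)

lemma J_mat_carrier [simp]: "J_mat \<alpha> \<in> carrier_mat (length \<alpha>) (length \<alpha>)"
  by (simp add: J_mat_def)

section \<open>Coefficient vectors and the matrix V\<close>

definition qpoly_of_vec :: "quat vec \<Rightarrow> qpoly" where
  "qpoly_of_vec v = (\<Sum>j<dim_vec v. Poly_Mapping.single j (v $ j))"

lemma lookup_qpoly_of_vec:
  "Poly_Mapping.lookup (qpoly_of_vec v) i = (if i < dim_vec v then v $ i else 0)"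
  by (simp add: qpoly_of_vec_def lookup_sum lookup_single when_def)

lemma qZ_power: "qZ ^ j = Poly_Mapping.single j 1"
  by (induction j) (simp_all add: qZ_def mult_single)

lemma ldd_sum: "finite A \<Longrightarrow> ldd xs (\<Sum>j\<in>A. F j) = (\<Sum>j\<in>A. ldd xs (F j))"
proof (induction A rule: finite_induct)
  case empty
  show ?case using ldd_add [of xs 0 0] by simp
qed (simp add: ldd_add)

text \<open>The columns of \<open>V_mat\<close> are the divided differences of the powers of z, and
  divided differences are linear for coefficients on the right.\<close>

lemma Delta_l_qpoly_of_vec:
  assumes "dim_vec v = length \<alpha>"
  shows "Delta_l \<alpha> (qpoly_of_vec v) = V_mat \<alpha> *\<^sub>v v"
proof (intro eq_vecI)
  fix i assume "i < dim_vec (V_mat \<alpha> *\<^sub>v v)"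
  then have i: "i < length \<alpha>" by (simp add: V_mat_def)
  have "ldd xs (Poly_Mapping.single j c) = ldd xs (qZ ^ j) * c" for xs j c
    using ldd_mult_const [of xs "qZ ^ j" c] by (simp add: qZ_power mult_single)
  then show "Delta_l \<alpha> (qpoly_of_vec v) $ i = (V_mat \<alpha> *\<^sub>v v) $ i"
    using i assms
    by (simp add: Delta_l_def V_mat_def qpoly_of_vec_def ldd_sum scalar_prod_def
        lessThan_atLeast0)
qed (simp add: Delta_l_def V_mat_def)

section \<open>Multiplication by z and the matrix J\<close>

text \<open>Each division leaves a constant beside z times the old quotient, and the next division
  annihilates that constant. Hence only the most recent divided difference survives.\<close>

lemma fold_left_quot_qZ_mult:
  assumes "i < length \<alpha>"
  shows "fold left_quot (take (Suc i) \<alpha>) (qZ * f)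
    = qconst (Delta_l \<alpha> f $ i) + qZ * fold left_quot (take (Suc i) \<alpha>) f"
  using assms
proof (induction i)
  case 0
  then show ?case by (simp add: take_Suc_conv_app_nth Delta_l_index left_quot_qZ_mult)
next
  case (Suc i)
  then have i: "i < length \<alpha>" by simp
  show ?case
    unfolding take_Suc_conv_app_nth [OF Suc.prems] fold_append comp_def Suc.IH [OF i]
    by (simp add: left_quot_add left_quot_qZ_mult Delta_l_index Suc.prems)
qed

lemma Delta_l_qZ_mult: "Delta_l \<alpha> (qZ * f) = J_mat \<alpha> *\<^sub>v Delta_l \<alpha> f"
proof (intro eq_vecI)
  fix i assume "i < dim_vec (J_mat \<alpha> *\<^sub>v Delta_l \<alpha> f)"
  then have i: "i < length \<alpha>" by (simp add: J_mat_def)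
  have J: "(J_mat \<alpha> *\<^sub>v Delta_l \<alpha> f) $ i
      = (\<Sum>j<length \<alpha>. (if i = j then \<alpha> ! i else if i = Suc j then 1 else 0) * Delta_l \<alpha> f $ j)"
    using i by (simp add: J_mat_def Delta_l_def scalar_prod_def lessThan_atLeast0)
  show "Delta_l \<alpha> (qZ * f) $ i = (J_mat \<alpha> *\<^sub>v Delta_l \<alpha> f) $ i"
  proof (cases i)
    case 0
    have "(J_mat \<alpha> *\<^sub>v Delta_l \<alpha> f) $ i
        = (\<Sum>j<length \<alpha>. if j = i then \<alpha> ! i * Delta_l \<alpha> f $ i else 0)"
      unfolding J using 0 by (intro sum.cong) auto
    with 0 i show ?thesis by (simp add: Delta_l_index left_eval_qZ_mult)
  next
    case (Suc m)
    have "(J_mat \<alpha> *\<^sub>v Delta_l \<alpha> f) $ i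
        = (\<Sum>j<length \<alpha>. (if j = i then \<alpha> ! i * Delta_l \<alpha> f $ i else 0)
            + (if j = m then Delta_l \<alpha> f $ m else 0))"
      unfolding J using Suc by (intro sum.cong) auto
    also have "\<dots> = \<alpha> ! i * Delta_l \<alpha> f $ i + Delta_l \<alpha> f $ m"
      using i Suc by (simp add: sum.distrib)
    moreover have "Delta_l \<alpha> (qZ * f) $ i = Delta_l \<alpha> f $ m + \<alpha> ! i * Delta_l \<alpha> f $ i"
    proof -
      have "m < length \<alpha>" using i Suc by simp
      then have "fold left_quot (take i \<alpha>) (qZ * f)
          = qconst (Delta_l \<alpha> f $ m) + qZ * fold left_quot (take i \<alpha>) f"
        unfolding Suc by (rule fold_left_quot_qZ_mult)
      then show ?thesis
        unfolding Delta_l_index [OF i] by (simp add: left_eval_add left_eval_single left_eval_qZ_mult)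
    qed
    ultimately show ?thesis by (simp add: add.commute)
  qed
qed (simp add: Delta_l_def J_mat_def)

lemma Delta_l_qZ_power_mult:
  "Delta_l \<alpha> (qZ ^ m * f) = J_mat \<alpha> ^\<^sub>m m *\<^sub>v Delta_l \<alpha> f"
proof (induction m arbitrary: f)
  case 0
  have "dim_row (J_mat \<alpha>) = length \<alpha>" by (simp add: J_mat_def)
  then show ?case using one_mult_mat_vec [OF Delta_l_carrier] by simp
next
  case (Suc m)
  have "Delta_l \<alpha> (qZ ^ Suc m * f) = J_mat \<alpha> ^\<^sub>m m *\<^sub>v (J_mat \<alpha> *\<^sub>v Delta_l \<alpha> f)"
    by (simp only: power_Suc2 mult.assoc Suc.IH Delta_l_qZ_mult)
  then show ?case
    using assoc_mult_mat_vec [OF pow_carrier_mat [OF J_mat_carrier] J_mat_carrier Delta_l_carrier]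
    by simp
qed

section \<open>Chains and powers of chi\<close>

text \<open>Division by \<open>z - a\<close> consumes one \<open>chi\<close> and leaves its other
  factor \<open>z - qcnj a\<close>, which moves past the remaining powers. These conjugate factors
  pile up on the left of \<open>f\<close>.\<close>

lemma fold_left_quot_chi_power:
  assumes "\<forall>x\<in>set xs. in_class t n x" and "length xs \<le> m"
  shows "fold left_quot xs (chi t n ^ m * f)
    = chi t n ^ (m - length xs) * fold (\<lambda>a h. (qZ - qconst (qcnj a)) * h) xs f"
  using assms
proof (induction xs arbitrary: m f)
  case (Cons a xs)
  then obtain l where m: "m = Suc l" by (cases m) auto
  have a: "in_class t n a" using Cons.prems by simp
  have "chi t n ^ m * f = (qZ - qconst a) * ((qZ - qconst (qcnj a)) * (chi t n ^ l * f))"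
    by (simp add: m mult.assoc chi_mult [OF a])
  also have "(qZ - qconst (qcnj a)) * (chi t n ^ l * f) = chi t n ^ l * ((qZ - qconst (qcnj a)) * f)"
    by (simp only: mult.assoc [symmetric] chi_power_commute)
  finally have "left_quot a (chi t n ^ m * f) = chi t n ^ l * ((qZ - qconst (qcnj a)) * f)"
    by simp
  then show ?case using Cons.IH [of l "(qZ - qconst (qcnj a)) * f"] Cons.prems m by simp
qed simp

text \<open>When entry \<open>i\<close> is evaluated, only \<open>i\<close> factors
  \<open>chi\<close> have been consumed. At least one remains, and it has
  \<open>z - \<alpha> ! i\<close> as a left factor.\<close>

lemma Delta_l_chi_power_mult:
  assumes "\<forall>x\<in>set \<alpha>. in_class t n x"
  shows "Delta_l \<alpha> (chi t n ^ length \<alpha> * f) = 0\<^sub>v (length \<alpha>)"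
proof (intro eq_vecI)
  fix i assume "i < dim_vec (0\<^sub>v (length \<alpha>) :: quat vec)"
  then have i: "i < length \<alpha>" by simp
  then obtain l where l: "length \<alpha> - i = Suc l" by (metis Suc_diff_Suc)
  have "\<forall>x\<in>set (take i \<alpha>). in_class t n x" using assms by (auto dest: in_set_takeD)
  moreover have "in_class t n (\<alpha> ! i)" using assms i by simp
  ultimately show "Delta_l \<alpha> (chi t n ^ length \<alpha> * f) $ i = 0\<^sub>v (length \<alpha>) $ i"
    using i l by (simp add: Delta_l_index fold_left_quot_chi_power mult.assoc chi_mult left_eval_factor)
qed (simp add: Delta_l_def)

text \<open>Every vanishing divided difference splits off one more linear factor, until the degree
  bound is exhausted. This yields the injectivity of \<open>V_mat\<close>.\<close>

lemma Delta_l_eq_0_deg_below: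
  assumes "Delta_l \<alpha> f = 0\<^sub>v (length \<alpha>)" and "deg_below (length \<alpha>) f"
  shows "f = 0"
proof -
  have "\<forall>i<length \<alpha>. left_eval (fold left_quot (take i \<alpha>) f) (\<alpha> ! i) = 0"
    using assms(1) Delta_l_index [of _ \<alpha> f] by simp
  with assms(2) show ?thesis
  proof (induction \<alpha> arbitrary: f)
    case Nil
    then show ?case by (simp add: deg_below_0)
  next
    case (Cons a \<alpha>)
    have "left_eval f a = 0" using Cons.prems(2) by force
    then have f: "f = (qZ - qconst a) * left_quot a f" by (rule left_eval_0_factor)
    then have "deg_below (length (a # \<alpha>) - 1) (left_quot a f)"
      using Cons.prems(1) deg_below_factor by metis
    moreover have "\<forall>i<length \<alpha>. left_eval (fold left_quot (take i \<alpha>) (left_quot a f)) (\<alpha> ! i) = 0"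
      using Cons.prems(2) by (metis Suc_less_eq fold_simps(2) length_Cons nth_Cons_Suc take_Suc_Cons)
    ultimately have "left_quot a f = 0" using Cons.IH by simp
    then show ?case using f by simp
  qed
qed

text \<open>If \<open>(z - c) h\<close> vanishes at a point of the class other than \<open>c\<close>, then \<open>h\<close> vanishes at the
  conjugate of \<open>c\<close>. For a chain this moves a zero at \<open>\<alpha>\<^sub>m\<close> back to \<open>\<alpha>\<^sub>1\<close>, one entry at a time.\<close>

lemma chain_zero_at_head:
  assumes "spherical_chain \<alpha>" and "\<forall>x\<in>set \<alpha>. in_class t n x" and "m < length \<alpha>"
    and "Delta_l \<alpha> (chi t n ^ m * f) = 0\<^sub>v (length \<alpha>)"
  shows "left_eval f (\<alpha> ! 0) = 0"
proof -
  define H where "H i = fold (\<lambda>a h. (qZ - qconst (qcnj a)) * h) (take i \<alpha>) f" for i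
  have "\<forall>x\<in>set (take m \<alpha>). in_class t n x" using assms by (auto dest: in_set_takeD)
  \<comment> \<open>At entry \<open>m\<close> all \<open>m\<close> factors \<open>chi\<close> are
    used up, so \<open>H m\<close> itself is evaluated.\<close>
  then have "left_eval (H m) (\<alpha> ! m) = 0"
    using assms(3) arg_cong [OF assms(4), of "\<lambda>v. v $ m"]
    by (simp add: Delta_l_index fold_left_quot_chi_power H_def)
  with assms(3) have "left_eval (H 0) (\<alpha> ! 0) = 0"
  proof (induction m)
    case (Suc m)
    have "H (Suc m) = (qZ - qconst (qcnj (\<alpha> ! m))) * H m"
      using Suc.prems by (simp add: H_def take_Suc_conv_app_nth)
    \<comment> \<open>Here the condition on consecutive chain entries enters: the new point must
      differ from the zero of the linear factor.\<close>
    moreover have "\<alpha> ! Suc m \<noteq> qcnj (\<alpha> ! m)"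
      using assms(1) Suc.prems by (simp add: spherical_chain_def)
    moreover have "in_class t n (\<alpha> ! Suc m)" "in_class t n (qcnj (\<alpha> ! m))"
      using assms(2) Suc.prems by (auto intro: in_class_qcnj)
    ultimately have "left_eval (H m) (qcnj (qcnj (\<alpha> ! m))) = 0"
      using left_eval_factor_eq_0 Suc.prems(2) by metis
    then show ?case using Suc by simp
  qed simp
  then show ?thesis by (simp add: H_def)
qed

text \<open>For \<open>m = k\<close>, together with \<open>Delta_l_chi_power_mult\<close>, this
  identifies the polynomials annihilated by both chains as the multiples of the k-th power of
  \<open>chi\<close>.\<close>

lemma common_kernel_chi_power:
  assumes "spherical_chain \<alpha>" and "\<forall>x\<in>set \<alpha>. in_class t n x"
    and "spherical_chain \<beta>" and "\<forall>x\<in>set \<beta>. in_class t n x"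
    and "length \<alpha> = k" and "length \<beta> = k" and "\<alpha> ! 0 \<noteq> \<beta> ! 0"
    and "Delta_l \<alpha> f = 0\<^sub>v k" and "Delta_l \<beta> f = 0\<^sub>v k" and "m \<le> k"
  shows "\<exists>g. f = chi t n ^ m * g"
  using \<open>m \<le> k\<close>
proof (induction m)
  case (Suc m)
  then obtain g where g: "f = chi t n ^ m * g" by auto
  have "left_eval g (\<alpha> ! 0) = 0" "left_eval g (\<beta> ! 0) = 0"
    using chain_zero_at_head [OF assms(1,2), of m g] chain_zero_at_head [OF assms(3,4), of m g]
      assms(5-9) Suc.prems g by simp_all
  moreover have "in_class t n (\<alpha> ! 0)" "in_class t n (\<beta> ! 0)"
    using assms by (auto simp: spherical_chain_def)
  ultimately obtain h where "g = chi t n * h"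
    using chi_dvd_of_two_zeros assms(7) by blast
  then have "f = chi t n ^ Suc m * h"
    using g by (simp add: mult.assoc [symmetric] power_commutes)
  then show ?case ..
qed simp

section \<open>The comparison of three chains\<close>

lemma V_mat_inverse:
  "\<exists>W \<in> carrier_mat (length \<alpha>) (length \<alpha>).
    V_mat \<alpha> * W = 1\<^sub>m (length \<alpha>) \<and> W * V_mat \<alpha> = 1\<^sub>m (length \<alpha>)"
proof (rule inj_mat_inverse [OF V_mat_carrier])
  fix v assume v: "v \<in> carrier_vec (length \<alpha>)" "V_mat \<alpha> *\<^sub>v v = 0\<^sub>v (length \<alpha>)"
  then have "qpoly_of_vec v = 0"
    by (intro Delta_l_eq_0_deg_below [of \<alpha>])
      (auto simp: Delta_l_qpoly_of_vec deg_below_def lookup_qpoly_of_vec)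
  then have "v $ i = 0" if "i < length \<alpha>" for i
    using lookup_qpoly_of_vec [of v i] that v(1) by simp
  then show "v = 0\<^sub>v (length \<alpha>)" using v(1) by (intro eq_vecI) auto
qed

lemma invertible_matI:
  assumes "A \<in> carrier_mat n n" and "B \<in> carrier_mat n n"
    and "A * B = 1\<^sub>m n" and "B * A = 1\<^sub>m n"
  shows "invertible_mat A" and "mat_inv A = B"
proof -
  have inv: "inverts_mat A B" "inverts_mat B A"
    using assms by (simp_all add: inverts_mat_def)
  then show "invertible_mat A"
    using assms(1) unfolding invertible_mat_def by auto
  show "mat_inv A = B"
    by (rule mat_inv_unique [OF inv])
qed

lemma
  fixes \<alpha> :: "quat list"
  defines "k \<equiv> length \<alpha>"
  shows invertible_V_mat: "invertible_mat (V_mat \<alpha>)"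
    and mat_inv_V_mat_carrier: "mat_inv (V_mat \<alpha>) \<in> carrier_mat k k"
    and V_mat_mat_inv: "V_mat \<alpha> * mat_inv (V_mat \<alpha>) = 1\<^sub>m k"
    and mat_inv_V_mat: "mat_inv (V_mat \<alpha>) * V_mat \<alpha> = 1\<^sub>m k"
proof -
  obtain W where W: "W \<in> carrier_mat k k" "V_mat \<alpha> * W = 1\<^sub>m k" "W * V_mat \<alpha> = 1\<^sub>m k"
    using V_mat_inverse unfolding k_def by blast
  have V: "V_mat \<alpha> \<in> carrier_mat k k" by (simp add: k_def)
  show "invertible_mat (V_mat \<alpha>)" "mat_inv (V_mat \<alpha>) \<in> carrier_mat k k"
    "V_mat \<alpha> * mat_inv (V_mat \<alpha>) = 1\<^sub>m k" "mat_inv (V_mat \<alpha>) * V_mat \<alpha> = 1\<^sub>m k"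
    using invertible_matI [OF V W] W by simp_all
qed

lemma T_mat_carrier: "T_mat \<alpha> \<in> carrier_mat (length \<alpha>) (length \<alpha>)"
  unfolding T_mat_def
  by (intro mult_carrier_mat [OF mult_carrier_mat [OF mat_inv_V_mat_carrier pow_carrier_mat]]
      J_mat_carrier V_mat_carrier)

text \<open>By construction \<open>V T = J^k V\<close>. Thus \<open>T v\<close> lists the
  coefficients of the polynomial of degree below k with the same divided differences as z^k times
  the polynomial of \<open>v\<close>.\<close>

lemma Delta_l_shifted_qpoly_of_vec:
  assumes "v \<in> carrier_vec (length \<alpha>)"
  shows "Delta_l \<alpha> (qZ ^ length \<alpha> * qpoly_of_vec v) = V_mat \<alpha> *\<^sub>v (T_mat \<alpha> *\<^sub>v v)"
proof -
  define k where "k = length \<alpha>"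
  let ?V = "V_mat \<alpha>" and ?W = "mat_inv (V_mat \<alpha>)" and ?J = "J_mat \<alpha> ^\<^sub>m k"
  have V: "?V \<in> carrier_mat k k" and W: "?W \<in> carrier_mat k k" and J: "?J \<in> carrier_mat k k"
    and VW: "?V * ?W = 1\<^sub>m k"
    using mat_inv_V_mat_carrier [of \<alpha>] V_mat_mat_inv [of \<alpha>] by (simp_all add: k_def)
  have v: "v \<in> carrier_vec k" using assms by (simp add: k_def)
  define u where "u = ?J *\<^sub>v (?V *\<^sub>v v)"
  have u: "u \<in> carrier_vec k" using V J v by (simp add: u_def)
  have "T_mat \<alpha> *\<^sub>v v = ?W *\<^sub>v u"
    using V W J v by (simp add: T_mat_def k_def [symmetric] u_def assoc_mult_mat_vec [of _ k k _ k])
  then have "?V *\<^sub>v (T_mat \<alpha> *\<^sub>v v) = (?V * ?W) *\<^sub>v u"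
    using V W u by simp
  also have "\<dots> = u" using VW u by simp
  finally show ?thesis
    using assms by (simp add: Delta_l_qZ_power_mult Delta_l_qpoly_of_vec u_def k_def)
qed

lemma lookup_qZ_power_mult:
  "Poly_Mapping.lookup (qZ ^ m * f) i = (if i < m then 0 else Poly_Mapping.lookup f (i - m))"
proof (induction m arbitrary: i)
  case (Suc m)
  have "Poly_Mapping.lookup (qZ ^ Suc m * f) i = Poly_Mapping.lookup (qZ * (qZ ^ m * f)) i"
    by (simp only: power_Suc mult.assoc)
  then show ?case
    by (cases i) (simp_all add: lookup_qZ_mult Suc.IH)
qed simp

lemma T_mat_diff_inverse:
  assumes \<alpha>: "spherical_chain \<alpha>" "\<forall>x\<in>set \<alpha>. in_class t n x" "length \<alpha> = k"
    and \<beta>: "spherical_chain \<beta>" "\<forall>x\<in>set \<beta>. in_class t n x" "length \<beta> = k"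
    and ne: "\<alpha> ! 0 \<noteq> \<beta> ! 0"
  shows "\<exists>C \<in> carrier_mat k k.
    (T_mat \<alpha> - T_mat \<beta>) * C = 1\<^sub>m k \<and> C * (T_mat \<alpha> - T_mat \<beta>) = 1\<^sub>m k"
proof (rule inj_mat_inverse)
  have T: "T_mat \<alpha> \<in> carrier_mat k k" "T_mat \<beta> \<in> carrier_mat k k"
    using T_mat_carrier \<alpha>(3) \<beta>(3) by metis+
  then show "T_mat \<alpha> - T_mat \<beta> \<in> carrier_mat k k" by (simp add: minus_carrier_mat)
  fix v assume v: "v \<in> carrier_vec k" and "(T_mat \<alpha> - T_mat \<beta>) *\<^sub>v v = 0\<^sub>v k"
  then have d: "T_mat \<alpha> *\<^sub>v v - T_mat \<beta> *\<^sub>v v = 0\<^sub>v k"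
    using T by (simp add: minus_mult_distrib_mat_vec)
  define w where "w = T_mat \<alpha> *\<^sub>v v"
  have w: "w \<in> carrier_vec k" using T v by (simp add: w_def)
  have w': "w = T_mat \<beta> *\<^sub>v v"
  proof (intro eq_vecI)
    fix i assume "i < dim_vec (T_mat \<beta> *\<^sub>v v)"
    then show "w $ i = (T_mat \<beta> *\<^sub>v v) $ i"
      using arg_cong [OF d, of "\<lambda>v. v $ i"] T by (simp add: w_def)
  qed (use T in \<open>simp add: w_def\<close>)
  define f where "f = qZ ^ k * qpoly_of_vec v + qpoly_of_vec (- w)"
  \<comment> \<open>Stated for an arbitrary \<gamma> because \<open>w\<close> is the image of
    \<open>v\<close> under both \<open>T_mat \<alpha>\<close> and
    \<open>T_mat \<beta>\<close>.\<close>
  have zero: "Delta_l \<gamma> f = 0\<^sub>v k" if \<gamma>: "length \<gamma> = k" "w = T_mat \<gamma> *\<^sub>v v" for \<gamma>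
  proof -
    have V: "V_mat \<gamma> \<in> carrier_mat k k" using \<gamma>(1) V_mat_carrier by metis
    have "Delta_l \<gamma> (qZ ^ k * qpoly_of_vec v) = V_mat \<gamma> *\<^sub>v w"
      using Delta_l_shifted_qpoly_of_vec [of v \<gamma>] \<gamma> v by simp
    moreover have "Delta_l \<gamma> (qpoly_of_vec (- w)) = V_mat \<gamma> *\<^sub>v (- w)"
      using \<gamma>(1) w by (intro Delta_l_qpoly_of_vec) simp
    ultimately have "Delta_l \<gamma> f = V_mat \<gamma> *\<^sub>v w + V_mat \<gamma> *\<^sub>v (- w)"
      by (simp add: f_def Delta_l_add)
    also have "\<dots> = V_mat \<gamma> *\<^sub>v (w + - w)"
      using V w by (intro mult_add_distrib_mat_vec [symmetric]) auto
    also have "w + - w = 0\<^sub>v k" using w by (intro eq_vecI) auto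
    finally show ?thesis using V by (intro eq_vecI) (auto simp: scalar_prod_def)
  qed
  obtain g where g: "f = chi t n ^ k * g"
    using common_kernel_chi_power [OF \<alpha>(1,2) \<beta>(1,2) \<alpha>(3) \<beta>(3) ne zero zero order_refl]
      \<alpha>(3) \<beta>(3) w' w_def by blast
  have "deg_below (2 * k) f"
    using v w by (auto simp: deg_below_def f_def lookup_add lookup_qZ_power_mult lookup_qpoly_of_vec)
  moreover have "in_class t n (\<alpha> ! 0)" using \<alpha> by (auto simp: spherical_chain_def)
  ultimately have "g = 0" using chi_power_mult_eq_0 g by blast
  then have "f = 0" using g by simp
  \<comment> \<open>The polynomial of \<open>- w\<close> stops below degree \<open>k\<close>, so the
    coefficients of \<open>f\<close> from degree \<open>k\<close> on are those of
    \<open>v\<close>.\<close>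
  have "v $ i = 0" if "i < k" for i
  proof -
    have "Poly_Mapping.lookup f (k + i) = v $ i"
      using that v w by (simp add: f_def lookup_add lookup_qZ_power_mult lookup_qpoly_of_vec)
    with \<open>f = 0\<close> show ?thesis by simp
  qed
  then show "v = 0\<^sub>v k" using v by (intro eq_vecI) auto
qed

text \<open>The vectors \<open>p\<close> and \<open>q\<close> are the lower and upper halves of the
  remainder of \<open>f\<close> modulo the k-th power of \<open>chi\<close>. They are quantified
  before \<alpha> since this remainder does not involve the chain.\<close>

lemma Delta_l_normal_form:
  assumes a: "in_class t n a"
  shows "\<exists>p q. p \<in> carrier_vec k \<and> q \<in> carrier_vec k
    \<and> (\<forall>\<alpha>. length \<alpha> = k \<longrightarrow> (\<forall>x\<in>set \<alpha>. in_class t n x) \<longrightarrow>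
        Delta_l \<alpha> f = V_mat \<alpha> *\<^sub>v (p + T_mat \<alpha> *\<^sub>v q))"
proof -
  obtain g r where f: "f = chi t n ^ k * g + r" and r: "deg_below (2 * k) r"
    using chi_power_division [OF a] by blast
  define p where "p = vec k (Poly_Mapping.lookup r)"
  define q where "q = vec k (\<lambda>i. Poly_Mapping.lookup r (k + i))"
  have pq: "p \<in> carrier_vec k" "q \<in> carrier_vec k" by (simp_all add: p_def q_def)
  have "r = qpoly_of_vec p + qZ ^ k * qpoly_of_vec q"
    using r by (intro poly_mapping_eqI)
      (auto simp: lookup_add lookup_qZ_power_mult lookup_qpoly_of_vec p_def q_def deg_below_def)
  then have f': "f = chi t n ^ k * g + (qpoly_of_vec p + qZ ^ k * qpoly_of_vec q)"
    using f by simp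
  have "Delta_l \<alpha> f = V_mat \<alpha> *\<^sub>v (p + T_mat \<alpha> *\<^sub>v q)"
    if \<alpha>: "length \<alpha> = k" "\<forall>x\<in>set \<alpha>. in_class t n x" for \<alpha>
  proof -
    have V: "V_mat \<alpha> \<in> carrier_mat k k" and T: "T_mat \<alpha> \<in> carrier_mat k k"
      using \<alpha>(1) V_mat_carrier T_mat_carrier by metis+
    have "Delta_l \<alpha> f = 0\<^sub>v k + (V_mat \<alpha> *\<^sub>v p + V_mat \<alpha> *\<^sub>v (T_mat \<alpha> *\<^sub>v q))"
      unfolding f' Delta_l_add
      using Delta_l_chi_power_mult [OF \<alpha>(2)] Delta_l_qpoly_of_vec [of p \<alpha>]
        Delta_l_shifted_qpoly_of_vec [of q \<alpha>] \<alpha>(1) pq by simp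
    also have "\<dots> = V_mat \<alpha> *\<^sub>v (p + T_mat \<alpha> *\<^sub>v q)"
      using V T pq by (simp add: mult_add_distrib_mat_vec [of _ k k])
    finally show ?thesis .
  qed
  with pq show ?thesis by blast
qed

text \<open>Linear Lagrange interpolation of \<open>p + T q\<close> with matrix nodes
  \<open>T1\<close> and \<open>T2\<close>. Writing x and y for the images of the two node values
  under \<open>C\<close>, one has \<open>x - y = q\<close> and
  \<open>(T1 - T2) y = p + T2 q\<close>; the left side is
  \<open>(T3 - T2) x - (T3 - T1) y\<close>.\<close>

lemma mat_vec_interpolation:
  fixes T1 T2 T3 C :: "'a :: ring_1 mat"
  assumes T: "T1 \<in> carrier_mat k k" "T2 \<in> carrier_mat k k" "T3 \<in> carrier_mat k k"
    and C: "C \<in> carrier_mat k k" "(T1 - T2) * C = 1\<^sub>m k" "C * (T1 - T2) = 1\<^sub>m k"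
    and p: "p \<in> carrier_vec k" and q: "q \<in> carrier_vec k"
  shows "(T3 - T2) *\<^sub>v (C *\<^sub>v (p + T1 *\<^sub>v q)) + (T3 - T1) *\<^sub>v (- C *\<^sub>v (p + T2 *\<^sub>v q))
    = p + T3 *\<^sub>v q"
proof -
  define x where "x = C *\<^sub>v (p + T1 *\<^sub>v q)"
  define y where "y = C *\<^sub>v (p + T2 *\<^sub>v q)"
  have x: "x \<in> carrier_vec k" and y: "y \<in> carrier_vec k"
    using T C(1) p q unfolding x_def y_def
    by (auto intro!: mult_mat_vec_carrier [of _ k k])
  have D: "T1 - T2 \<in> carrier_mat k k" using T by (simp add: minus_carrier_mat)
  have xy: "x - y = q"
  proof -
    have "x - y = C *\<^sub>v ((p + T1 *\<^sub>v q) - (p + T2 *\<^sub>v q))"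
      unfolding x_def y_def using T C p q
      by (intro mult_minus_distrib_mat_vec [symmetric]) auto
    also have "(p + T1 *\<^sub>v q) - (p + T2 *\<^sub>v q) = (T1 - T2) *\<^sub>v q"
      using T p q by (subst minus_mult_distrib_mat_vec [of _ k k]) (auto intro!: eq_vecI)
    also have "C *\<^sub>v ((T1 - T2) *\<^sub>v q) = (C * (T1 - T2)) *\<^sub>v q"
      using assoc_mult_mat_vec [OF C(1) D q] by simp
    also have "\<dots> = q" using C(3) q by simp
    finally show ?thesis .
  qed
  have x': "x = y + q"
    using x y q unfolding xy [symmetric] by (intro eq_vecI) auto
  have "T1 *\<^sub>v y - T2 *\<^sub>v y = (T1 - T2) *\<^sub>v y"
    using T y by (simp add: minus_mult_distrib_mat_vec [of _ k k])
  also have "\<dots> = ((T1 - T2) * C) *\<^sub>v (p + T2 *\<^sub>v q)"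
    unfolding y_def using D C(1) T p q by (intro assoc_mult_mat_vec [symmetric]) auto
  also have "\<dots> = p + T2 *\<^sub>v q" using C(2) T p q by simp
  finally have y': "T1 *\<^sub>v y - T2 *\<^sub>v y = p + T2 *\<^sub>v q" .
  have "(T3 - T2) *\<^sub>v x + (T3 - T1) *\<^sub>v (- y)
      = T3 *\<^sub>v q + (T1 *\<^sub>v y - T2 *\<^sub>v y) - T2 *\<^sub>v q"
  proof -
    have "(T3 - T1) *\<^sub>v (- y) = T1 *\<^sub>v y - T3 *\<^sub>v y"
    proof -
      have "- y = 0\<^sub>v k - y" using y by (intro eq_vecI) auto
      moreover have "(T3 - T1) *\<^sub>v (0\<^sub>v k - y) = (T3 - T1) *\<^sub>v 0\<^sub>v k - (T3 - T1) *\<^sub>v y"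
        using T y by (intro mult_minus_distrib_mat_vec) (auto simp: minus_carrier_mat)
      moreover have "(T3 - T1) *\<^sub>v 0\<^sub>v k = 0\<^sub>v k"
        using T by (intro eq_vecI) (auto simp: scalar_prod_def)
      moreover have "(T3 - T1) *\<^sub>v y = T3 *\<^sub>v y - T1 *\<^sub>v y"
        using T y by (intro minus_mult_distrib_mat_vec)
      ultimately show ?thesis
        using T y by (intro eq_vecI) auto
    qed
    moreover have "(T3 - T2) *\<^sub>v x = T3 *\<^sub>v y + T3 *\<^sub>v q - (T2 *\<^sub>v y + T2 *\<^sub>v q)"
      unfolding x' using T y q
      by (simp add: minus_mult_distrib_mat_vec [of _ k k] mult_add_distrib_mat_vec [of _ k k])
    ultimately show ?thesis
      using T y q by (intro eq_vecI) auto
  qed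
  also have "\<dots> = p + T3 *\<^sub>v q"
    unfolding y' using T p q by (intro eq_vecI) auto
  moreover have "- C *\<^sub>v (p + T2 *\<^sub>v q) = - y"
    using T C p q by (simp add: y_def)
  ultimately show ?thesis by (simp add: x_def)
qed

theorem theorem5p3:
  fixes S :: "quat set" and \<alpha>1 \<alpha>2 \<alpha>3 :: "quat list" and k :: nat
  assumes "S \<in> UNIV // qconj_rel"
    and "spherical_chain \<alpha>1" and "spherical_chain \<alpha>2" and "spherical_chain \<alpha>3"
    and "length \<alpha>1 = k" and "length \<alpha>2 = k" and "length \<alpha>3 = k"
    and "set \<alpha>1 \<subseteq> S" and "set \<alpha>2 \<subseteq> S" and "set \<alpha>3 \<subseteq> S"
    and "\<alpha>1 ! 0 \<noteq> \<alpha>2 ! 0"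
  shows "invertible_mat (V_mat \<alpha>1) \<and> invertible_mat (V_mat \<alpha>2) \<and> invertible_mat (V_mat \<alpha>3)
    \<and> invertible_mat (T_mat \<alpha>1 - T_mat \<alpha>2) \<and> invertible_mat (T_mat \<alpha>2 - T_mat \<alpha>1)
    \<and> (\<forall>f :: qpoly. Delta_l \<alpha>3 f =
          (V_mat \<alpha>3 * (T_mat \<alpha>3 - T_mat \<alpha>2) * mat_inv (T_mat \<alpha>1 - T_mat \<alpha>2)
             * mat_inv (V_mat \<alpha>1)) *\<^sub>v Delta_l \<alpha>1 f
        + (V_mat \<alpha>3 * (T_mat \<alpha>3 - T_mat \<alpha>1) * mat_inv (T_mat \<alpha>2 - T_mat \<alpha>1)
             * mat_inv (V_mat \<alpha>2)) *\<^sub>v Delta_l \<alpha>2 f)"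
proof -
  obtain t n where S: "\<forall>x\<in>S. in_class t n x"
    using conjugacy_class_in_class [OF assms(1)] by blast
  have cl: "\<forall>x\<in>set \<alpha>1. in_class t n x" "\<forall>x\<in>set \<alpha>2. in_class t n x" "\<forall>x\<in>set \<alpha>3. in_class t n x"
    using S assms(8-10) by auto
  let ?V1 = "V_mat \<alpha>1" and ?V2 = "V_mat \<alpha>2" and ?V3 = "V_mat \<alpha>3"
  let ?T1 = "T_mat \<alpha>1" and ?T2 = "T_mat \<alpha>2" and ?T3 = "T_mat \<alpha>3"
  have T: "?T1 \<in> carrier_mat k k" "?T2 \<in> carrier_mat k k" "?T3 \<in> carrier_mat k k"
    using T_mat_carrier assms(5-7) by metis+
  have V: "?V1 \<in> carrier_mat k k" "?V2 \<in> carrier_mat k k" "?V3 \<in> carrier_mat k k"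
    using V_mat_carrier assms(5-7) by metis+
  have W: "mat_inv ?V1 \<in> carrier_mat k k" "mat_inv ?V2 \<in> carrier_mat k k"
    "mat_inv ?V1 * ?V1 = 1\<^sub>m k" "mat_inv ?V2 * ?V2 = 1\<^sub>m k"
    using mat_inv_V_mat_carrier [of \<alpha>1] mat_inv_V_mat_carrier [of \<alpha>2]
      mat_inv_V_mat [of \<alpha>1] mat_inv_V_mat [of \<alpha>2] assms(5,6) by simp_all
  have D: "?T1 - ?T2 \<in> carrier_mat k k" "?T2 - ?T1 \<in> carrier_mat k k"
    "?T3 - ?T2 \<in> carrier_mat k k" "?T3 - ?T1 \<in> carrier_mat k k"
    using T by (simp_all add: minus_carrier_mat)
  obtain C where C: "C \<in> carrier_mat k k" "(?T1 - ?T2) * C = 1\<^sub>m k" "C * (?T1 - ?T2) = 1\<^sub>m k"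
    using T_mat_diff_inverse [OF assms(2) cl(1) assms(5) assms(3) cl(2) assms(6) assms(11)] by blast
  \<comment> \<open>One inverse serves both formulas: \<open>- C\<close> inverts the opposite
    difference.\<close>
  have neg: "?T2 - ?T1 = - (?T1 - ?T2)"
    using T by (intro eq_matI) auto
  have C': "- C \<in> carrier_mat k k" "(?T2 - ?T1) * - C = 1\<^sub>m k" "- C * (?T2 - ?T1) = 1\<^sub>m k"
    unfolding neg using C T by auto
  have inv: "mat_inv (?T1 - ?T2) = C" "mat_inv (?T2 - ?T1) = - C"
    "invertible_mat (?T1 - ?T2)" "invertible_mat (?T2 - ?T1)"
    using invertible_matI [OF D(1) C] invertible_matI [OF D(2) C'] by auto
  \<comment> \<open>Chains are nonempty, so the head supplies the point at which \<open>chi\<close>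
    is factored for the normal form.\<close>
  have "\<alpha>1 ! 0 \<in> set \<alpha>1" using assms(2) by (simp add: spherical_chain_def)
  then have a: "in_class t n (\<alpha>1 ! 0)" using cl by blast
  \<comment> \<open>Both summands have this shape: the inverse of V cancels the V in the normal form
    of the divided differences.\<close>
  have comb: "(?V3 * X * Y * W) *\<^sub>v (V *\<^sub>v u) = ?V3 *\<^sub>v (X *\<^sub>v (Y *\<^sub>v u))"
    if "X \<in> carrier_mat k k" "Y \<in> carrier_mat k k" "W \<in> carrier_mat k k" "V \<in> carrier_mat k k"
      "W * V = 1\<^sub>m k" "u \<in> carrier_vec k" for X Y W V u
  proof -
    have "W *\<^sub>v (V *\<^sub>v u) = u"
      using assoc_mult_mat_vec [OF that(3,4,6)] that(5,6) by simp
    then show ?thesis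
      using that \<open>?V3 \<in> carrier_mat k k\<close> by (simp add: assoc_mult_mat_vec [of _ k k _ k])
  qed
  have "Delta_l \<alpha>3 f = (?V3 * (?T3 - ?T2) * C * mat_inv ?V1) *\<^sub>v Delta_l \<alpha>1 f
      + (?V3 * (?T3 - ?T1) * - C * mat_inv ?V2) *\<^sub>v Delta_l \<alpha>2 f" for f
  proof -
    obtain p q where pq: "p \<in> carrier_vec k" "q \<in> carrier_vec k"
      and nf: "\<And>\<alpha>. length \<alpha> = k \<Longrightarrow> \<forall>x\<in>set \<alpha>. in_class t n x \<Longrightarrow>
        Delta_l \<alpha> f = V_mat \<alpha> *\<^sub>v (p + T_mat \<alpha> *\<^sub>v q)"
      using Delta_l_normal_form [OF a, of k f] by blast
    define u1 u2 where "u1 = p + ?T1 *\<^sub>v q" and "u2 = p + ?T2 *\<^sub>v q"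
    have u: "u1 \<in> carrier_vec k" "u2 \<in> carrier_vec k"
      using pq T by (simp_all add: u1_def u2_def)
    have 1: "(?V3 * (?T3 - ?T2) * C * mat_inv ?V1) *\<^sub>v Delta_l \<alpha>1 f
        = ?V3 *\<^sub>v ((?T3 - ?T2) *\<^sub>v (C *\<^sub>v u1))"
      unfolding nf [OF assms(5) cl(1)] u1_def [symmetric]
      by (rule comb [OF D(3) C(1) W(1) V(1) W(3) u(1)])
    have 2: "(?V3 * (?T3 - ?T1) * - C * mat_inv ?V2) *\<^sub>v Delta_l \<alpha>2 f
        = ?V3 *\<^sub>v ((?T3 - ?T1) *\<^sub>v (- C *\<^sub>v u2))"
      unfolding nf [OF assms(6) cl(2)] u2_def [symmetric]
      by (rule comb [OF D(4) C'(1) W(2) V(2) W(4) u(2)])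
    have "Delta_l \<alpha>3 f = ?V3 *\<^sub>v ((?T3 - ?T2) *\<^sub>v (C *\<^sub>v u1) + (?T3 - ?T1) *\<^sub>v (- C *\<^sub>v u2))"
      unfolding u1_def u2_def mat_vec_interpolation [OF T C pq]
      by (rule nf [OF assms(7) cl(3)])
    also have "\<dots> = ?V3 *\<^sub>v ((?T3 - ?T2) *\<^sub>v (C *\<^sub>v u1)) + ?V3 *\<^sub>v ((?T3 - ?T1) *\<^sub>v (- C *\<^sub>v u2))"
      using V(3) D(3,4) C(1) C'(1) u by (intro mult_add_distrib_mat_vec) auto
    finally show ?thesis unfolding 1 2 .
  qed
  with inv invertible_V_mat show ?thesis by simp
qed

end
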